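(* Let $(J,\mathcal{A})$ be a standard Borel space, $\psi$ a finite nonnegative measure on $\mathcal{A}\times\mathcal{A}$, and $s,t\in J$. There is an $s$-$t$ flow $\varphi$ of value $1$ with $\varphi\le\psi$ if and only if $\psi(A\times A^c)\ge1$ for every $A\in\mathcal{A}$ with $s\in A$ and $t\notin A$.
   Context: For $a\in\mathbb{R}$, an $s$-$t$ flow of value $a$ is a finite nonnegative measure $\varphi$ on $\mathcal{A}\times\mathcal{A}$ such that $\varphi^1-\varphi^2=a(\delta_s-\delta_t)$, where $\varphi^1(A)=\varphi(A\times J)$, $\varphi^2(A)=\varphi(J\times A)$ and $\delta_x$ is the Dirac measure at $x$. $A^c=J\setminus A$; $\varphi\le\psi$ is setwise. *)

theory Defs
  imports "HOL-Probability.Giry_Monad"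
begin

text \<open>
  A measurable space \<open>(J, \<A>)\<close> is represented by a measure \<open>M\<close> with \<open>space M = J\<close> and
  \<open>sets M = \<A>\<close>; the values of the measure \<open>M\<close> play no role.
\<close>

definition standard_borel :: "'a measure \<Rightarrow> bool" where
  "standard_borel M \<longleftrightarrow>
    (\<exists>X. topspace X = space M \<and> completely_metrizable_space X \<and> separable_space X \<and>
         sets M = sigma_sets (space M) {U. openin X U})"

definition finite_measure_on :: "'b measure \<Rightarrow> 'b measure \<Rightarrow> bool" where
  "finite_measure_on N \<phi> \<longleftrightarrow> sets \<phi> = sets N \<and> finite_measure \<phi>"

text \<open>
  \<open>return M x\<close> is the Dirac measure at \<open>x\<close>. The defining equation is between finite
  signed measures, so it is stated setwise, with real values.
\<close>

definition st_flow :: "'a measure \<Rightarrow> 'a \<Rightarrow> 'a \<Rightarrow> real \<Rightarrow> ('a \<times> 'a) measure \<Rightarrow> bool" where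
  "st_flow M s t a \<phi> \<longleftrightarrow>
    finite_measure_on (M \<Otimes>\<^sub>M M) \<phi> \<and>
    (\<forall>A\<in>sets M. measure \<phi> (A \<times> space M) - measure \<phi> (space M \<times> A) =
       a * (measure (return M s) A - measure (return M t) A))"

end

theory Submission
  imports Defs
begin

text \<open>
  A flow below \<open>\<psi>\<close> has a density \<open>f\<close> with values in \<open>[0, 1]\<close> with respect to \<open>\<psi>\<close>, and the flow equation
  need only be checked on a countable generating \<open>\<pi>\<close>-system \<open>A\<^sub>0, A\<^sub>1, \<dots>\<close>. Let \<open>f\<close> minimize
  \<open>\<Phi>(f) = (\<Sum>n. e\<^sub>n\<^sup>2 / 2^n)\<close>, where \<open>e\<^sub>n\<close> is the error in the flow equation for \<open>A\<^sub>n\<close>, and put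
  \<open>g = - (\<Sum>n. e\<^sub>n 1\<^sub>A\<^sub>n / 2^n)\<close>. Stationarity at \<open>f\<close> bounds the integral of \<open>max 0 (g(x) - g(y))\<close> over \<open>\<psi>\<close>
  from above by \<open>g(s) - g(t) - \<Phi>(f)\<close>, and the cut condition, applied to the level sets of \<open>g\<close>, bounds
  it from below by \<open>g(s) - g(t)\<close>. Hence \<open>\<Phi>(f) = 0\<close>.
\<close>

section \<open>Countable generating pi-systems of standard Borel spaces\<close>

lemma metrizable_separable_imp_second_countable:
  assumes "metrizable_space X" and "separable_space X"
  shows "second_countable X"
proof -
  obtain S d where "Metric_space S d" and X: "X = Metric_space.mtopology S d"
    using assms(1) unfolding metrizable_space_def by blast
  then interpret Metric_space S d
    by simp
  obtain C where C: "countable C" "C \<subseteq> S" "mtopology closure_of C = S"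
    using assms(2) unfolding separable_space_def X by auto
  let ?B = "(\<lambda>(c, q). mball c (of_rat q)) ` (C \<times> (UNIV :: rat set))"
  have "\<exists>V\<in>?B. x \<in> V \<and> V \<subseteq> U" if U: "openin mtopology U" "x \<in> U" for U x
  proof -
    obtain r where r: "r > 0" "mball x r \<subseteq> U" and xS: "x \<in> S"
      using U openin_mtopology by blast
    \<comment> \<open>A radius below \<open>r / 2\<close> leaves room for two uses of the triangle
      inequality: the ball about a dense point \<open>c\<close> near \<open>x\<close> contains
      \<open>x\<close> and still lies within distance \<open>r\<close> of \<open>x\<close>.\<close>
    obtain q :: rat where q: "0 < (of_rat q :: real)" "of_rat q < r / 2"
      using of_rat_dense[of 0 "r / 2"] r by auto
    have "x \<in> mtopology closure_of C"
      using C(3) xS by simp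
    then obtain c where c: "c \<in> C" "c \<in> mball x (of_rat q)"
      using q(1) xS unfolding metric_closure_of by blast
    have "x \<in> mball c (of_rat q)"
      using c commute by (simp add: in_mball)
    moreover have "mball c (of_rat q) \<subseteq> mball x r"
      using c q by (intro mball_subset) (auto simp: commute)
    ultimately show ?thesis
      using c(1) r(2) by (intro bexI[of _ "mball c (of_rat q)"]) auto
  qed
  then show ?thesis
    unfolding second_countable_def X using C(1)
    by (intro exI[of _ ?B]) (auto intro!: countable_image)
qed

text \<open>Closing a countable base of the topology under finite intersections keeps it countable
  and open and makes it a pi-system. Every open set is a countable union of base members, so the
  generated sigma-algebra is the full Borel one.\<close>

lemma standard_borel_countable_generator:
  assumes "standard_borel M"
  obtains A :: "nat \<Rightarrow> 'a set"
  where "Int_stable (range A)" "space M \<in> range A" "sets M = sigma_sets (space M) (range A)"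
proof -
  obtain X where X: "topspace X = space M" "completely_metrizable_space X" "separable_space X"
      "sets M = sigma_sets (space M) {U. openin X U}"
    using assms unfolding standard_borel_def by blast
  then have "second_countable X"
    by (simp add: completely_metrizable_imp_metrizable_space metrizable_separable_imp_second_countable)
  then obtain \<B> where B: "countable \<B>" "\<And>V. V \<in> \<B> \<Longrightarrow> openin X V"
      "\<And>U x. openin X U \<Longrightarrow> x \<in> U \<Longrightarrow> \<exists>V\<in>\<B>. x \<in> V \<and> V \<subseteq> U"
    unfolding second_countable_def by metis
  \<comment> \<open>Intersecting with \<open>space M\<close> lets the empty family contribute the
    whole space; a bare empty intersection would be the universe of the type.\<close>
  define P where "P = (\<lambda>F. space M \<inter> \<Inter>F) ` {F. finite F \<and> F \<subseteq> \<B>}"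
  have P_countable: "countable P"
    unfolding P_def by (intro countable_image countable_Collect_finite_subset B)
  have P_space: "space M \<in> P"
    unfolding P_def by (rule image_eqI[of _ _ "{}"]) auto
  have P_Int: "Int_stable P"
    unfolding Int_stable_def P_def
  proof safe
    fix F G assume "finite F" "F \<subseteq> \<B>" "finite G" "G \<subseteq> \<B>"
    then show "space M \<inter> \<Inter>F \<inter> (space M \<inter> \<Inter>G) \<in> (\<lambda>F. space M \<inter> \<Inter>F) ` {F. finite F \<and> F \<subseteq> \<B>}"
      by (intro image_eqI[of _ _ "F \<union> G"]) auto
  qed
  have P_open: "openin X U" if U: "U \<in> P" for U
  proof -
    obtain F where F: "U = space M \<inter> \<Inter>F" "finite F" "F \<subseteq> \<B>"
      using U unfolding P_def by blast
    have "openin X (space M \<inter> \<Inter>F)"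
      using F(2,3)
      by induction (use X(1) in \<open>auto simp: Int_left_commute intro: openin_Int openin_topspace[of X, unfolded X(1)] B(2)\<close>)
    then show ?thesis
      using F by simp
  qed
  have B_P: "\<B> \<subseteq> P"
  proof
    fix V assume "V \<in> \<B>"
    then show "V \<in> P"
      unfolding P_def using B(2)[of V] X(1) openin_subset[of X V] by (intro image_eqI[of _ _ "{V}"]) auto
  qed
  have open_P: "U \<in> sigma_sets (space M) P" if "openin X U" for U
  proof -
    have "U = \<Union>{V \<in> \<B>. V \<subseteq> U}"
      using B(3) that by blast
    moreover have "\<Union>{V \<in> \<B>. V \<subseteq> U} \<in> sigma_sets (space M) P"
      using B(1) B_P by (intro sigma_sets_UNION) (auto intro: countable_subset)
    ultimately show ?thesis
      by simp
  qed
  have "sets M = sigma_sets (space M) P"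
    unfolding X(4)
    by (intro equalityI sigma_sets_mono sigma_sets_mono') (use open_P P_open in auto)
  moreover have "range (from_nat_into P) = P"
    using P_space P_countable by (intro range_from_nat_into) auto
  ultimately show ?thesis
    using P_Int P_space that[of "from_nat_into P"] by simp
qed

section \<open>Uniqueness for differences of finite measures\<close>

text \<open>A pi-lambda argument for signed measures written as differences: the sets of agreement
  are closed under countable disjoint unions because the real series converge, and under complements
  because agreement on \<Omega> itself is part of \<open>eq\<close>.\<close>

lemma finite_measure_diff_eqI:
  assumes fin: "finite_measure M" "finite_measure M'" "finite_measure N" "finite_measure N'"
    and sets: "sets M = sigma_sets \<Omega> G" "sets M' = sigma_sets \<Omega> G"
      "sets N = sigma_sets \<Omega> G" "sets N' = sigma_sets \<Omega> G"
    and G: "Int_stable G" "G \<subseteq> Pow \<Omega>" "\<Omega> \<in> G"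
    and eq: "\<And>X. X \<in> G \<Longrightarrow> measure M X - measure M' X = measure N X - measure N' X"
    and A: "A \<in> sigma_sets \<Omega> G"
  shows "measure M A - measure M' A = measure N A - measure N' A"
proof -
  have sp: "space M = \<Omega>" "space M' = \<Omega>" "space N = \<Omega>" "space N' = \<Omega>"
    using sets G(2) by (metis sigma_algebra_sigma_sets sigma_algebra.sets_measure_of_eq sigma_algebra.space_measure_of_eq sets_eq_imp_space_eq)+
  from G(1,2) A show ?thesis
  proof (induction rule: sigma_sets_induct_disjoint)
    case (basic A)
    then show ?case by (rule eq)
  next
    case empty
    then show ?case by simp
  next
    case (compl A)
    have "measure Q (\<Omega> - A) = measure Q \<Omega> - measure Q A"
      if "finite_measure Q" "space Q = \<Omega>" "sets Q = sigma_sets \<Omega> G" for Q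
      using finite_measure.finite_measure_compl[OF that(1), of A] that compl by simp
    then show ?case
      using compl(2) eq[OF G(3)] fin sets sp by simp
  next
    case (union A)
    have s: "(\<lambda>i. measure Q (A i)) sums measure Q (\<Union>i. A i)"
      if "finite_measure Q" "sets Q = sigma_sets \<Omega> G" for Q
      using union that by (intro finite_measure.finite_measure_UNION) auto
    have "(\<lambda>i. measure M (A i) - measure M' (A i)) sums (measure M (\<Union>i. A i) - measure M' (\<Union>i. A i))"
      "(\<lambda>i. measure N (A i) - measure N' (A i)) sums (measure N (\<Union>i. A i) - measure N' (\<Union>i. A i))"
      using s fin sets by (auto intro!: sums_diff)
    then show ?case
      using union(3) sums_unique2 by simp
  qed
qed

section \<open>Minimization over [0,1]-valued densities\<close>

text \<open>These are densities of measures dominated by \<open>N\<close>. The bounds hold at every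
  point of the type rather than almost everywhere, so that averages of such functions need no null
  sets.\<close>

definition unit_functions :: "'b measure \<Rightarrow> ('b \<Rightarrow> real) set" where
  "unit_functions N = {f \<in> borel_measurable N. \<forall>x. 0 \<le> f x \<and> f x \<le> 1}"

lemma (in finite_measure) integrable_bounded_by:
  fixes f :: "'a \<Rightarrow> real"
  assumes "f \<in> borel_measurable M" and "\<And>x. \<bar>f x\<bar> \<le> B"
  shows "integrable M f"
  by (rule integrable_const_bound[of _ B]) (use assms in auto)

text \<open>
  Near-minimizers of almost minimal \<open>L\<^sup>2\<close> norm form a Cauchy sequence by the parallelogram law;
  this replaces weak compactness.
\<close>
lemma (in finite_measure) convex_functional_attains_minimum:
  fixes \<Phi> :: "('a \<Rightarrow> real) \<Rightarrow> real"
  assumes nonneg: "\<And>f. f \<in> unit_functions M \<Longrightarrow> 0 \<le> \<Phi> f"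
    and mid: "\<And>f g. f \<in> unit_functions M \<Longrightarrow> g \<in> unit_functions M \<Longrightarrow>
      \<Phi> (\<lambda>x. (f x + g x) / 2) \<le> max (\<Phi> f) (\<Phi> g)"
    and cont: "\<And>u f. (\<And>n. u n \<in> unit_functions M) \<Longrightarrow> f \<in> unit_functions M \<Longrightarrow>
      (AE x in M. (\<lambda>n. u n x) \<longlonglongrightarrow> f x) \<Longrightarrow> (\<lambda>n. \<Phi> (u n)) \<longlonglongrightarrow> \<Phi> f"
  obtains f where "f \<in> unit_functions M" "\<forall>g\<in>unit_functions M. \<Phi> f \<le> \<Phi> g"
proof -
  let ?F = "unit_functions M"
  define d where "d = Inf (\<Phi> ` ?F)"
  have zero: "(\<lambda>x. 0) \<in> ?F"
    by (simp add: unit_functions_def)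
  have bdd: "bdd_below (\<Phi> ` ?F)"
    using nonneg by (intro bdd_belowI[of _ 0]) auto
  have d_le: "d \<le> \<Phi> f" if "f \<in> ?F" for f
    unfolding d_def using that bdd by (auto intro: cInf_lower)
  \<comment> \<open>These sets decrease in \<open>n\<close> and, by \<open>mid\<close>, are closed
    under midpoints. By \<open>cont\<close>, an almost everywhere limit of functions from ever
    smaller \<open>K n\<close> will be a minimizer if it is a unit function.\<close>
  define K where "K n = {f \<in> ?F. \<Phi> f < d + 1 / real (Suc n)}" for n
  have K_ne: "K n \<noteq> {}" for n
  proof -
    have "\<exists>y\<in>\<Phi> ` ?F. y < d + 1 / real (Suc n)"
      using zero bdd unfolding d_def by (intro cInf_lessD) (auto simp: less_add_same_cancel1)
    then show ?thesis
      by (auto simp: K_def)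
  qed
  have K_anti: "K m \<subseteq> K n" if "n \<le> m" for n m
  proof -
    have "1 / real (Suc m) \<le> 1 / real (Suc n)"
      using that by (simp add: frac_le)
    then show ?thesis
      by (auto simp: K_def)
  qed
  have meas: "f \<in> borel_measurable M" and bnd: "0 \<le> f x" "f x \<le> 1" if "f \<in> ?F" for f x
    using that by (auto simp: unit_functions_def)
  have K_F: "K n \<subseteq> ?F" for n
    by (auto simp: K_def)
  have intgb: "integrable M (\<lambda>x. (f x)\<^sup>2)" "integrable M (\<lambda>x. f x * g x)" if "f \<in> ?F" "g \<in> ?F" for f g
    using meas bnd that by (auto intro!: integrable_bounded_by[of _ 1] mult_le_one simp: abs_mult power_le_one)
  define q where "q f = (\<integral>x. (f x)\<^sup>2 \<partial>M)" for f :: "'a \<Rightarrow> real"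
  \<comment> \<open>Since the sets \<open>K n\<close> shrink, these infima increase; the total mass
    bounds them, so they converge.\<close>
  define N where "N n = Inf (q ` K n)" for n
  have q_nonneg: "0 \<le> q f" for f
    by (simp add: q_def)
  have q_bdd: "bdd_below (q ` K n)" for n
    using q_nonneg by (intro bdd_belowI[of _ 0]) auto
  have q_le: "q f \<le> measure M (space M)" if "f \<in> ?F" for f
  proof -
    have "q f \<le> (\<integral>x. 1 \<partial>M)"
      unfolding q_def using intgb that bnd[OF that] by (intro integral_mono) (auto simp: power_le_one)
    then show ?thesis
      by simp
  qed
  have N_le: "N n \<le> q f" if "f \<in> K n" for n f
    unfolding N_def using that q_bdd by (auto intro: cInf_lower)
  have N_mono: "incseq N"
    unfolding incseq_def N_def using K_ne K_anti q_bdd by (auto intro!: cInf_superset_mono image_mono)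
  have "N n \<le> measure M (space M)" for n
    using N_le K_ne[of n] q_le K_F[of n] by (meson ex_in_conv order_trans subsetD)
  then obtain L where L: "N \<longlonglongrightarrow> L"
    using incseq_convergent[OF N_mono] by blast
  have "\<exists>f. f \<in> K n \<and> q f < N n + 1 / real (Suc n)" for n
  proof -
    have "\<exists>y\<in>q ` K n. y < N n + 1 / real (Suc n)"
      using K_ne q_bdd unfolding N_def by (intro cInf_lessD) (auto simp: less_add_same_cancel1)
    then show ?thesis
      by auto
  qed
  then obtain u where u: "\<And>n. u n \<in> K n" "\<And>n. q (u n) < N n + 1 / real (Suc n)"
    by metis
  have uF: "u n \<in> ?F" for n
    using u(1) K_F by blast
  \<comment> \<open>For \<open>n \<le> m\<close> both \<open>u n\<close> and \<open>u m\<close> lie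
    in \<open>K n\<close>, and so does their midpoint, whose \<open>q\<close> is at least
    \<open>N n\<close>. The parallelogram law then bounds the squared distance by 2 (N n + 1/(n+1))
    + 2 (L + 1/(n+1)) - 4 N n.\<close>
  define \<epsilon> where "\<epsilon> n = 2 * (L - N n) + 4 / real (Suc n)" for n
  have close: "(\<integral>x. (u n x - u m x)\<^sup>2 \<partial>M) \<le> \<epsilon> n" if "n \<le> m" for n m
  proof -
    have umK: "u m \<in> K n"
      using K_anti that u(1) by blast
    let ?h = "\<lambda>x. (u n x + u m x) / 2"
    have hF: "?h \<in> ?F"
      using uF[of n] uF[of m] by (auto simp: unit_functions_def add_nonneg_nonneg intro: order_trans[OF add_mono[of _ 1 _ 1]])
    then have "?h \<in> K n"
      using mid[OF uF[of n] uF[of m]] u(1)[of n] umK by (auto simp: K_def)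
    then have "N n \<le> q ?h"
      by (rule N_le)
    moreover have "(\<integral>x. (u n x - u m x)\<^sup>2 \<partial>M) = 2 * q (u n) + 2 * q (u m) - 4 * q ?h"
    proof -
      have "(u n x - u m x)\<^sup>2 = 2 * (u n x)\<^sup>2 + 2 * (u m x)\<^sup>2 - 4 * (?h x)\<^sup>2" for x
        by (simp add: power2_eq_square field_simps)
      then show ?thesis
        unfolding q_def using intgb[OF uF uF] intgb[OF hF hF] by simp
    qed
    moreover have "q (u m) < L + 1 / real (Suc n)"
    proof -
      have "1 / real (Suc m) \<le> 1 / real (Suc n)"
        using that by (simp add: frac_le)
      then show ?thesis
        using u(2)[of m] incseq_le[OF N_mono L, of m] by linarith
    qed
    ultimately show ?thesis
      using u(2)[of n] unfolding \<epsilon>_def by simp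
  qed
  have inv0: "(\<lambda>n. 1 / real (Suc n)) \<longlonglongrightarrow> 0"
    using LIMSEQ_inverse_real_of_nat by (simp only: inverse_eq_divide)
  have \<epsilon>0: "\<epsilon> \<longlonglongrightarrow> 0"
  proof -
    have "(\<lambda>n. 2 * (L - N n) + 4 * (1 / real (Suc n))) \<longlonglongrightarrow> 2 * (L - L) + 4 * 0"
      by (intro tendsto_add tendsto_mult tendsto_diff L tendsto_const inv0)
    then show ?thesis
      by (simp add: \<epsilon>_def[abs_def])
  qed
  have diffI: "integrable M (\<lambda>x. \<bar>u n x - u m x\<bar>)" "integrable M (\<lambda>x. (u n x - u m x)\<^sup>2)" for n m
  proof -
    have b: "\<bar>u n x - u m x\<bar> \<le> 1" for x
      using bnd[OF uF[of n], of x] bnd[OF uF[of m], of x] by linarith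
    have "(u n x - u m x)\<^sup>2 \<le> 1" for x
      using b[of x] abs_square_le_1 by blast
    then show "integrable M (\<lambda>x. \<bar>u n x - u m x\<bar>)" "integrable M (\<lambda>x. (u n x - u m x)\<^sup>2)"
      using meas[OF uF] b by (auto intro!: integrable_bounded_by[of _ 1])
  qed
  \<comment> \<open>The pointwise inequality |y| <= c + y^2 / c trades the square-norm estimate for
    an L1 estimate, the form in which an almost everywhere Cauchy subsequence can be extracted.
    First \<open>c\<close> is chosen small, then \<open>n\<close> large.\<close>
  have L1: "(\<integral>x. norm (u n x - u m x) \<partial>M) \<le> c * measure M (space M) + \<epsilon> n / c"
    if "n \<le> m" "c > 0" for n m c
  proof -
    have "(\<integral>x. norm (u n x - u m x) \<partial>M) \<le> (\<integral>x. c + (u n x - u m x)\<^sup>2 / c \<partial>M)"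
    proof (rule integral_mono)
      fix x
      have "0 \<le> (\<bar>u n x - u m x\<bar> - c)\<^sup>2" "0 \<le> c * \<bar>u n x - u m x\<bar>"
        using that(2) by auto
      then have "c * \<bar>u n x - u m x\<bar> \<le> c * c + (u n x - u m x)\<^sup>2"
        unfolding power2_diff[of "\<bar>_\<bar>"] power2_abs by (simp add: power2_eq_square[of c] mult.commute)
      then have "\<bar>u n x - u m x\<bar> \<le> (c * c + (u n x - u m x)\<^sup>2) / c"
        using that(2) by (simp add: pos_le_divide_eq mult.commute)
      then show "norm (u n x - u m x) \<le> c + (u n x - u m x)\<^sup>2 / c"
        using that(2) by (simp add: add_divide_distrib)
    qed (use diffI in auto)
    also have "\<dots> = c * measure M (space M) + (\<integral>x. (u n x - u m x)\<^sup>2 \<partial>M) / c"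
      using diffI by simp
    also have "\<dots> \<le> c * measure M (space M) + \<epsilon> n / c"
      using close that by (simp add: divide_right_mono)
    finally show ?thesis .
  qed
  have cauchy: "\<exists>N. \<forall>i\<ge>N. \<forall>j\<ge>N. (\<integral>x. norm (u i x - u j x) \<partial>M) < e" if "e > 0" for e
  proof -
    \<comment> \<open>The added 1 keeps the denominator positive when the measure is zero.\<close>
    define c where "c = e / (2 * (measure M (space M) + 1))"
    have pos: "measure M (space M) + 1 > 0"
      by (simp add: add_nonneg_pos)
    then have c: "c > 0" "c * measure M (space M) < e / 2"
      using that by (auto simp: c_def field_simps)
    have "eventually (\<lambda>n. \<epsilon> n < c * (e / 2)) sequentially"
      using \<epsilon>0 c that by (intro order_tendstoD) auto
    then obtain n0 where n0: "\<And>n. n \<ge> n0 \<Longrightarrow> \<epsilon> n < c * (e / 2)"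
      unfolding eventually_sequentially by blast
    have "(\<integral>x. norm (u i x - u j x) \<partial>M) < e" if "n0 \<le> i" "i \<le> j" for i j
    proof -
      have "\<epsilon> i / c < e / 2"
        using n0[OF that(1)] c by (simp add: pos_divide_less_eq mult.commute)
      then show ?thesis
        using L1[OF that(2) c(1)] c(2) by linarith
    qed
    note ord = this
    have "(\<integral>x. norm (u i x - u j x) \<partial>M) < e" if "n0 \<le> i" "n0 \<le> j" for i j
    proof (cases "i \<le> j")
      case False
      then have "(\<integral>x. norm (u j x - u i x) \<partial>M) < e"
        using that by (intro ord) auto
      then show ?thesis
        by (subst norm_minus_commute)
    qed (use that ord in blast)
    then show ?thesis
      by blast
  qed
  have "integrable M (u n)" for n
    using meas[OF uF[of n]] bnd[OF uF[of n]] by (intro integrable_bounded_by[of _ 1]) auto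
  then obtain r where r: "strict_mono r" and ae: "AE x in M. Cauchy (\<lambda>i. u (r i) x)"
    using cauchy by (rule cauchy_L1_AE_cauchy_subseq[of M u])
  \<comment> \<open>Clamping enforces the bounds on the null set where the sequence may diverge and
    \<open>lim\<close> is unspecified; elsewhere it changes nothing.\<close>
  define f where "f x = max 0 (min 1 (lim (\<lambda>i. u (r i) x)))" for x
  have fF: "f \<in> ?F"
  proof -
    have [measurable]: "u n \<in> borel_measurable M" for n
      by (rule meas[OF uF])
    have "f \<in> borel_measurable M"
      unfolding f_def by measurable
    then show ?thesis
      by (simp add: unit_functions_def f_def)
  qed
  have "AE x in M. (\<lambda>i. u (r i) x) \<longlonglongrightarrow> f x"
    using ae
  proof eventually_elim
    case (elim x)
    then have lim: "(\<lambda>i. u (r i) x) \<longlonglongrightarrow> lim (\<lambda>i. u (r i) x)"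
      using Cauchy_convergent convergent_LIMSEQ_iff by blast
    have "0 \<le> lim (\<lambda>i. u (r i) x)" "lim (\<lambda>i. u (r i) x) \<le> 1"
      using LIMSEQ_le_const[OF lim, of 0] LIMSEQ_le_const2[OF lim, of 1] bnd[OF uF] by auto
    then show ?case
      using lim by (simp add: f_def)
  qed
  then have "(\<lambda>i. \<Phi> (u (r i))) \<longlonglongrightarrow> \<Phi> f"
    using uF fF by (intro cont) auto
  moreover have "(\<lambda>i. d + 1 / real (Suc (r i))) \<longlonglongrightarrow> d + 0"
    using LIMSEQ_subseq_LIMSEQ[OF inv0 r] by (intro tendsto_add tendsto_const) (simp only: o_def)
  moreover have "\<Phi> (u (r i)) \<le> d + 1 / real (Suc (r i))" for i
    using u(1)[of "r i"] by (simp add: K_def)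
  ultimately have "\<Phi> f \<le> d + 0"
    by (intro LIMSEQ_le[of "\<lambda>i. \<Phi> (u (r i))"]) auto
  then show ?thesis
    using d_le by (intro that[OF fF]) fastforce
qed

section \<open>Potential differences and cuts\<close>

text \<open>Layer-cake decomposition: each level set \<open>{g > r}\<close> with \<open>g t \<le> r < g s\<close> is an \<open>s\<close>-\<open>t\<close> cut.\<close>
lemma potential_difference_le:
  fixes \<psi> :: "('a \<times> 'a) measure" and g :: "'a \<Rightarrow> real"
  assumes fin: "finite_measure \<psi>" and sets: "sets \<psi> = sets (M \<Otimes>\<^sub>M M)"
    and g [measurable]: "g \<in> borel_measurable M" and bound: "\<And>x. \<bar>g x\<bar> \<le> B"
    and st: "s \<in> space M" "t \<in> space M"
    and cut: "\<And>A. A \<in> sets M \<Longrightarrow> s \<in> A \<Longrightarrow> t \<notin> A \<Longrightarrow> 1 \<le> measure \<psi> (A \<times> (space M - A))"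
  shows "g s - g t \<le> (\<integral>p. max 0 (g (fst p) - g (snd p)) \<partial>\<psi>)"
proof (cases "g t < g s")
  case True
  interpret finite_measure \<psi> by fact
  interpret P: pair_sigma_finite lborel \<psi>
    by unfold_locales
  have [measurable_cong]: "sets \<psi> = sets (M \<Otimes>\<^sub>M M)" by fact
  have sp: "space \<psi> = space M \<times> space M"
    using sets_eq_imp_space_eq[OF sets] by (simp add: space_pair_measure)
  let ?m = "\<lambda>p. max 0 (g (fst p) - g (snd p))"
  have m_int: "integrable \<psi> ?m"
  proof (rule integrable_const_bound[of _ "2 * B"])
    show "AE p in \<psi>. norm (?m p) \<le> 2 * B"
    proof (rule AE_I2)
      fix p
      show "norm (?m p) \<le> 2 * B"
        using bound[of "fst p"] bound[of "snd p"] by (auto simp: max_def)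
    qed
  qed measurable
  \<comment> \<open>For fixed \<open>r\<close> this marks the pairs leaving the level set
    \<open>{g > r}\<close>, so its integral is the cut value; for fixed \<open>p\<close> its
    integral over \<open>r\<close> is at most the positive part of the drop of \<open>g\<close>
    along \<open>p\<close>. Exchanging the two integrals compares them.\<close>
  define k :: "real \<Rightarrow> 'a \<times> 'a \<Rightarrow> ennreal" where
    "k r p = (if g t \<le> r \<and> r < g s \<and> g (snd p) \<le> r \<and> r < g (fst p) then 1 else 0)" for r p
  have [measurable]: "(\<lambda>(r, p). k r p) \<in> borel_measurable (lborel \<Otimes>\<^sub>M \<psi>)"
    unfolding k_def by measurable
  have "ennreal (g s - g t) = (\<integral>\<^sup>+r. indicator {g t..<g s} r \<partial>lborel)"
    using True by simp
  also have "\<dots> \<le> (\<integral>\<^sup>+r. (\<integral>\<^sup>+p. k r p \<partial>\<psi>) \<partial>lborel)"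
  proof (rule nn_integral_mono)
    fix r
    show "indicator {g t..<g s} r \<le> (\<integral>\<^sup>+p. k r p \<partial>\<psi>)"
    proof (cases "r \<in> {g t..<g s}")
      case r: True
      let ?A = "{x \<in> space M. r < g x}"
      have A: "?A \<in> sets M"
        by measurable
      have C: "?A \<times> (space M - ?A) \<in> sets \<psi>"
        unfolding sets using A by auto
      have "(\<integral>\<^sup>+p. k r p \<partial>\<psi>) = (\<integral>\<^sup>+p. indicator (?A \<times> (space M - ?A)) p \<partial>\<psi>)"
        using r by (intro nn_integral_cong) (auto simp: k_def sp indicator_def)
      also have "\<dots> = ennreal (measure \<psi> (?A \<times> (space M - ?A)))"
        using C by (simp add: emeasure_eq_measure)
      also have "\<dots> \<ge> 1"
        using cut[OF A] r st by simp
      finally show ?thesis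
        using r by simp
    qed simp
  qed
  also have "\<dots> = (\<integral>\<^sup>+p. (\<integral>\<^sup>+r. k r p \<partial>lborel) \<partial>\<psi>)"
    by (rule P.Fubini'[symmetric]) measurable
  also have "\<dots> \<le> (\<integral>\<^sup>+p. ennreal (?m p) \<partial>\<psi>)"
  proof (rule nn_integral_mono)
    fix p
    have "(\<integral>\<^sup>+r. k r p \<partial>lborel) \<le> (\<integral>\<^sup>+r. indicator {g (snd p)..<g (fst p)} r \<partial>lborel)"
      by (intro nn_integral_mono) (auto simp: k_def)
    also have "\<dots> \<le> ennreal (?m p)"
      by (cases "g (snd p) \<le> g (fst p)") auto
    finally show "(\<integral>\<^sup>+r. k r p \<partial>lborel) \<le> ennreal (?m p)" .
  qed
  also have "\<dots> = ennreal (\<integral>p. ?m p \<partial>\<psi>)"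
    using m_int by (intro nn_integral_eq_integral) auto
  finally show ?thesis
    by (subst (asm) ennreal_le_iff) (auto intro!: integral_nonneg_AE)
next
  case False
  moreover have "0 \<le> (\<integral>p. max 0 (g (fst p) - g (snd p)) \<partial>\<psi>)"
    by (intro integral_nonneg_AE) auto
  ultimately show ?thesis
    by linarith
qed

section \<open>Least-squares solution of the flow equations\<close>

text \<open>For \<open>u\<close> the indicator of a set, this is the outgoing minus the incoming
  mass of that set under the measure with density \<open>f\<close>; a general \<open>u\<close> is
  integrated against the difference of the two marginals.\<close>

definition net_outflow :: "('a \<times> 'a) measure \<Rightarrow> ('a \<Rightarrow> real) \<Rightarrow> ('a \<times> 'a \<Rightarrow> real) \<Rightarrow> real" where
  "net_outflow \<psi> u f = (\<integral>p. (u (fst p) - u (snd p)) * f p \<partial>\<psi>)"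

lemma summable_geometric_weights:
  fixes x :: "nat \<Rightarrow> real"
  assumes "\<And>n. \<bar>x n\<bar> \<le> D"
  shows "summable (\<lambda>n. (1 / 2) ^ n * x n)"
proof (rule summable_comparison_test'[of "\<lambda>n. D * (1 / 2) ^ n"])
  show "norm ((1 / 2) ^ n * x n) \<le> D * (1 / 2) ^ n" for n
    using assms[of n] by (simp add: abs_mult mult.commute mult_left_mono divide_right_mono)
qed (intro summable_mult summable_geometric, simp)

text \<open>Countably many linear equations are solved at once by weighted least squares. The
  first-order condition at a minimizer takes the place of a separation argument: it turns the
  residual into a potential to which the cuts apply.\<close>

lemma flow_density_exists:
  fixes \<psi> :: "('a \<times> 'a) measure" and A :: "nat \<Rightarrow> 'a set"
  assumes fin: "finite_measure \<psi>" and sets: "sets \<psi> = sets (M \<Otimes>\<^sub>M M)"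
    and st: "s \<in> space M" "t \<in> space M"
    and cut: "\<And>A. A \<in> sets M \<Longrightarrow> s \<in> A \<Longrightarrow> t \<notin> A \<Longrightarrow> 1 \<le> measure \<psi> (A \<times> (space M - A))"
    and A [measurable]: "\<And>n. A n \<in> sets M"
  obtains f where "f \<in> unit_functions \<psi>"
    "\<forall>n. net_outflow \<psi> (indicator (A n)) f = indicator (A n) s - indicator (A n) t"
proof -
  interpret finite_measure \<psi> by fact
  have [measurable_cong]: "sets \<psi> = sets (M \<Otimes>\<^sub>M M)" by fact
  let ?F = "unit_functions \<psi>"
  have meas: "f \<in> borel_measurable \<psi>" and bnd: "0 \<le> f p" "f p \<le> 1" if "f \<in> ?F" for f p
    using that unfolding unit_functions_def by blast+
  define h :: "nat \<Rightarrow> 'a \<times> 'a \<Rightarrow> real"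
    where "h n p = indicator (A n) (fst p) - indicator (A n) (snd p)" for n p
  have [measurable]: "h n \<in> borel_measurable \<psi>" for n
    unfolding h_def by measurable
  have h_le: "\<bar>h n p\<bar> \<le> 1" for n p
    by (simp add: h_def indicator_def)
  define T where "T n f = (\<integral>p. h n p * f p \<partial>\<psi>)" for n and f :: "'a \<times> 'a \<Rightarrow> real"
  have T: "T n f = net_outflow \<psi> (indicator (A n)) f" for n f
    by (simp add: T_def net_outflow_def h_def)
  define b :: "nat \<Rightarrow> real" where "b n = indicator (A n) s - indicator (A n) t" for n
  define C where "C = measure \<psi> (space \<psi>)"
  define e where "e f n = T n f - b n" for f n
  have hf_le: "\<bar>h n p * f p\<bar> \<le> 1" if "f \<in> ?F" for n p f
    using h_le[of n p] bnd[OF that, of p] by (simp add: abs_mult mult_le_one)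
  have hf_int: "integrable \<psi> (\<lambda>p. h n p * f p)" if "f \<in> ?F" for n f
    using meas[OF that] hf_le[OF that] by (intro integrable_bounded_by[of _ 1]) auto
  have hf_norm: "(\<integral>p. norm (h n p * f p) \<partial>\<psi>) \<le> C" if "f \<in> ?F" for n f
  proof -
    have "(\<integral>p. norm (h n p * f p) \<partial>\<psi>) \<le> (\<integral>p. 1 \<partial>\<psi>)"
      using hf_int hf_le that by (intro integral_mono) auto
    then show ?thesis
      by (simp add: C_def)
  qed
  have T_le: "\<bar>T n f\<bar> \<le> C" if "f \<in> ?F" for n f
    using order_trans[OF integral_norm_bound hf_norm[OF that, of n]]
    unfolding T_def by (simp only: real_norm_def)
  have b_le: "\<bar>b n\<bar> \<le> 1" for n
    by (simp add: b_def indicator_def)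
  have e_le: "\<bar>e f n\<bar> \<le> C + 1" if "f \<in> ?F" for n f
    using T_le[OF that, of n] b_le[of n] unfolding e_def by linarith
  have C0: "0 \<le> C"
    by (simp add: C_def)
  have e2_le: "\<bar>(e f n)\<^sup>2\<bar> \<le> (C + 1)\<^sup>2" if "f \<in> ?F" for n f
    using e_le[OF that, of n] C0 by (simp add: abs_le_square_iff[symmetric])
  \<comment> \<open>The constant \<open>b n\<close> is respected because the weights
    \<open>1 - c\<close> and \<open>c\<close> sum to 1.\<close>
  have e_affine: "e (\<lambda>p. (1 - c) * f p + c * g p) n = (1 - c) * e f n + c * e g n"
    if "f \<in> ?F" "g \<in> ?F" for c f g n
  proof -
    have "h n p * ((1 - c) * f p + c * g p) = (1 - c) * (h n p * f p) + c * (h n p * g p)" for p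
      by (simp add: algebra_simps)
    then have "T n (\<lambda>p. (1 - c) * f p + c * g p) = (1 - c) * T n f + c * T n g"
      unfolding T_def using hf_int that by simp
    then show ?thesis
      by (simp add: e_def algebra_simps)
  qed
  define \<Phi> where "\<Phi> f = (\<Sum>n. (1 / 2) ^ n * (e f n)\<^sup>2)" for f
  have \<Phi>_summable: "summable (\<lambda>n. (1 / 2) ^ n * (e f n)\<^sup>2)" if "f \<in> ?F" for f
    using e2_le[OF that] by (rule summable_geometric_weights)
  have convex_F: "(\<lambda>p. (1 - c) * f p + c * g p) \<in> ?F" if "f \<in> ?F" "g \<in> ?F" "0 \<le> c" "c \<le> 1" for c f g
  proof -
    have "(1 - c) * f p + c * g p \<le> 1" for p
      using bnd[OF that(1)] bnd[OF that(2)] that by (intro convex_bound_le) auto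
    then show ?thesis
      using that by (auto simp: unit_functions_def)
  qed
  have nonneg: "0 \<le> \<Phi> f" if "f \<in> ?F" for f
    unfolding \<Phi>_def using \<Phi>_summable[OF that] by (intro suminf_nonneg) auto
  have mid: "\<Phi> (\<lambda>p. (f p + g p) / 2) \<le> max (\<Phi> f) (\<Phi> g)" if "f \<in> ?F" "g \<in> ?F" for f g
  proof -
    let ?k = "\<lambda>p. (f p + g p) / 2"
    have k: "?k = (\<lambda>p. (1 - 1 / 2) * f p + 1 / 2 * g p)"
      by (simp add: add_divide_distrib)
    have kF: "?k \<in> ?F"
      unfolding k using that by (intro convex_F) auto
    have "(e ?k n)\<^sup>2 \<le> ((e f n)\<^sup>2 + (e g n)\<^sup>2) / 2" for n
    proof -
      have "e ?k n = (e f n + e g n) / 2"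
        unfolding k using that by (subst e_affine) (auto simp: add_divide_distrib)
      moreover have "((a + b) / 2)\<^sup>2 \<le> (a\<^sup>2 + b\<^sup>2) / 2" for a b :: real
        using sum_squares_bound[of a b] by (simp add: power2_eq_square field_simps)
      ultimately show ?thesis
        by (simp only:)
    qed
    then have "\<Phi> ?k \<le> (\<Sum>n. ((1 / 2) ^ n * (e f n)\<^sup>2 + (1 / 2) ^ n * (e g n)\<^sup>2) / 2)"
      unfolding \<Phi>_def using \<Phi>_summable[OF kF] \<Phi>_summable that
      by (intro suminf_le summable_divide summable_add) (auto simp: divide_right_mono simp flip: distrib_left)
    also have "\<dots> = (\<Phi> f + \<Phi> g) / 2"
      unfolding \<Phi>_def using \<Phi>_summable that by (simp add: suminf_divide summable_add suminf_add)
    finally show ?thesis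
      by (simp add: max_def split: if_splits)
  qed
  have cont: "(\<lambda>k. \<Phi> (u k)) \<longlonglongrightarrow> \<Phi> f"
    if u: "\<And>k. u k \<in> ?F" and f: "f \<in> ?F" and ae: "AE p in \<psi>. (\<lambda>k. u k p) \<longlonglongrightarrow> f p" for u f
  proof -
    have "(\<lambda>k. T n (u k)) \<longlonglongrightarrow> T n f" for n
      unfolding T_def
    proof (rule integral_dominated_convergence[where w = "\<lambda>_. 1"])
      show "AE p in \<psi>. (\<lambda>k. h n p * u k p) \<longlonglongrightarrow> h n p * f p"
        using ae by eventually_elim (intro tendsto_intros)
    qed (use meas[OF u] meas[OF f] hf_le[OF u] in auto)
    then have lim: "(\<lambda>k. (1 / 2) ^ n * (e (u k) n)\<^sup>2) \<longlonglongrightarrow> (1 / 2) ^ n * (e f n)\<^sup>2" for n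
      unfolding e_def by (intro tendsto_intros)
    \<comment> \<open>The majorant is summable in \<open>n\<close> and independent of
      \<open>k\<close>, so Tannery's theorem carries the limit in \<open>k\<close> through the
      series.\<close>
    have bound: "\<forall>\<^sub>F (n, k) in sequentially \<times>\<^sub>F sequentially.
        norm ((1 / 2) ^ n * (e (u k) n)\<^sup>2) \<le> (C + 1)\<^sup>2 * (1 / 2) ^ n"
    proof (intro always_eventually allI, clarify)
      fix n k
      show "norm ((1 / 2) ^ n * (e (u k) n)\<^sup>2) \<le> (C + 1)\<^sup>2 * (1 / 2) ^ n"
        using e2_le[OF u, of k n] by (simp add: abs_mult mult.commute divide_right_mono)
    qed
    show ?thesis
      unfolding \<Phi>_def
      using tannerys_theorem[OF lim bound] by (auto intro!: summable_mult summable_geometric)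
  qed
  obtain f where f: "f \<in> ?F" and f_min: "\<forall>k\<in>?F. \<Phi> f \<le> \<Phi> k"
    using nonneg mid cont by (rule convex_functional_attains_minimum[of \<Phi>])
  \<comment> \<open>Moving a fraction \<open>c\<close> of the way from \<open>f\<close> to
    \<open>k\<close> changes \<Phi> by c (2 S + c Q), which is nonnegative by minimality. Dividing
    by \<open>c\<close> and letting \<open>c\<close> tend to 0 from the right leaves the linear
    term.\<close>
  have stationary: "0 \<le> (\<Sum>n. (1 / 2) ^ n * (e f n * (e k n - e f n)))" if k: "k \<in> ?F" for k
  proof -
    let ?d = "\<lambda>n. e k n - e f n"
    let ?S = "\<Sum>n. (1 / 2) ^ n * (e f n * ?d n)"
    let ?Q = "\<Sum>n. (1 / 2) ^ n * (?d n)\<^sup>2"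
    have d_le: "\<bar>?d n\<bar> \<le> 2 * (C + 1)" for n
      using order_trans[OF abs_triangle_ineq4 add_mono[OF e_le[OF k, of n] e_le[OF f, of n]]] by simp
    have S: "summable (\<lambda>n. (1 / 2) ^ n * (e f n * ?d n))"
      using e_le[OF f] d_le C0
      by (intro summable_geometric_weights[of _ "(C + 1) * (2 * (C + 1))"]) (auto simp: abs_mult intro!: mult_mono)
    have Q: "summable (\<lambda>n. (1 / 2) ^ n * (?d n)\<^sup>2)"
      using d_le C0
      by (intro summable_geometric_weights[of _ "(2 * (C + 1))\<^sup>2"]) (simp add: abs_le_square_iff[symmetric])
    have "0 \<le> 2 * ?S + c * ?Q" if c: "0 < c" "c \<le> 1" for c
    proof -
      let ?k = "\<lambda>p. (1 - c) * f p + c * k p"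
      have "(1 / 2) ^ n * (e ?k n)\<^sup>2 =
          (1 / 2) ^ n * (e f n)\<^sup>2 + c * (2 * ((1 / 2) ^ n * (e f n * ?d n)) + c * ((1 / 2) ^ n * (?d n)\<^sup>2))" for n
        unfolding e_affine[OF f k] by (simp add: power2_eq_square algebra_simps)
      then have "\<Phi> ?k = \<Phi> f + c * (2 * ?S + c * ?Q)"
        unfolding \<Phi>_def using \<Phi>_summable[OF f] S Q
        by (simp add: suminf_add[symmetric] suminf_mult summable_add summable_mult)
      then have "0 \<le> c * (2 * ?S + c * ?Q)"
        using bspec[OF f_min convex_F[OF f k, of c]] c by simp
      then show ?thesis
        using c by (simp add: zero_le_mult_iff)
    qed
    then have ev: "\<forall>\<^sub>F c in at_right 0. 0 \<le> 2 * ?S + c * ?Q"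
      unfolding eventually_at_right_field by (intro exI[of _ 1]) auto
    have "((\<lambda>c. 2 * ?S + c * ?Q) \<longlongrightarrow> 2 * ?S + 0 * ?Q) (at_right 0)"
      by (intro tendsto_intros)
    then have "0 \<le> 2 * ?S + 0 * ?Q"
      using ev by (rule tendsto_lowerbound) simp
    then show ?thesis
      by simp
  qed
  \<comment> \<open>With this sign, \<open>stationary\<close> says exactly that \<open>f\<close>
    maximizes \<open>net_outflow \<psi> g\<close> among the unit functions.\<close>
  define g where "g x = - (\<Sum>n. (1 / 2) ^ n * (e f n * indicator (A n) x))" for x
  have ei_le: "\<bar>e f n * indicator (A n) x\<bar> \<le> C + 1" for n x
    using e_le[OF f, of n] C0 by (simp add: indicator_def)
  have g_summable: "summable (\<lambda>n. (1 / 2) ^ n * (e f n * indicator (A n) x))" for x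
    using ei_le by (rule summable_geometric_weights)
  have g_diff: "g x - g y = - (\<Sum>n. (1 / 2) ^ n * (e f n * (indicator (A n) x - indicator (A n) y)))" for x y
    using suminf_diff[OF g_summable[of x] g_summable[of y]] unfolding g_def
    by (simp add: algebra_simps)
  have g_meas [measurable]: "g \<in> borel_measurable M"
    unfolding g_def by measurable
  have g_le: "\<bar>g x\<bar> \<le> 2 * (C + 1)" for x
  proof -
    have "\<bar>\<Sum>n. (1 / 2) ^ n * (e f n * indicator (A n) x)\<bar> \<le> (\<Sum>n. (C + 1) * (1 / 2) ^ n)"
      using ei_le[of _ x] by (intro norm_suminf_le[where 'a = real, unfolded real_norm_def] summable_mult summable_geometric)
        (auto simp: abs_mult mult.commute divide_right_mono)
    also have "\<dots> = 2 * (C + 1)"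
      by (subst suminf_mult) (auto simp: suminf_geometric summable_geometric)
    finally show ?thesis
      by (simp add: g_def)
  qed
  \<comment> \<open>Sum and integral can be exchanged because the L1 norms of the terms are at most
    C (C + 1) / 2^n.\<close>
  have g_flow: "net_outflow \<psi> g k = - (\<Sum>n. (1 / 2) ^ n * (e f n * T n k))" if k: "k \<in> ?F" for k
  proof -
    let ?G = "\<lambda>n p. (1 / 2) ^ n * (e f n * (h n p * k p))"
    have G_norm: "norm (?G n p) = (1 / 2) ^ n * \<bar>e f n\<bar> * norm (h n p * k p)" for n p
      by (simp add: abs_mult)
    have "(\<integral>p. (\<Sum>n. ?G n p) \<partial>\<psi>) = (\<Sum>n. \<integral>p. ?G n p \<partial>\<psi>)"
    proof (rule integral_suminf)
      show "AE p in \<psi>. summable (\<lambda>n. norm (?G n p))"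
      proof (rule AE_I2)
        fix p
        have "\<bar>e f n * (h n p * k p)\<bar> \<le> C + 1" for n
          using mult_mono[OF e_le[OF f, of n] hf_le[OF k, of n p]] C0 by (simp add: abs_mult)
        then show "summable (\<lambda>n. norm (?G n p))"
          using summable_geometric_weights[of "\<lambda>n. \<bar>e f n * (h n p * k p)\<bar>" "C + 1"] by (simp add: abs_mult)
      qed
      have "\<bar>\<bar>e f n\<bar> * (\<integral>p. norm (h n p * k p) \<partial>\<psi>)\<bar> \<le> (C + 1) * C" for n
        using mult_mono[OF e_le[OF f, of n] hf_norm[OF k, of n]] C0 by (simp add: abs_mult)
      from summable_geometric_weights[OF this]
      show "summable (\<lambda>n. \<integral>p. norm (?G n p) \<partial>\<psi>)"
        unfolding G_norm by (simp add: mult.assoc)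
    qed (use hf_int[OF k] in auto)
    moreover have "(g (fst p) - g (snd p)) * k p = - (\<Sum>n. ?G n p)" for p
    proof -
      have "\<bar>e f n * h n p\<bar> \<le> C + 1" for n
        using mult_mono[OF e_le[OF f, of n] h_le[of n p]] C0 by (simp add: abs_mult)
      from summable_geometric_weights[OF this] show ?thesis
        unfolding g_diff h_def[symmetric] by (simp add: suminf_mult2 mult.assoc)
    qed
    ultimately show ?thesis
      by (simp add: net_outflow_def T_def)
  qed
  have "g s - g t \<le> (\<integral>p. max 0 (g (fst p) - g (snd p)) \<partial>\<psi>)"
    using fin sets g_meas g_le st cut by (rule potential_difference_le)
  also have "\<dots> \<le> net_outflow \<psi> g f"
  proof -
    \<comment> \<open>The best competitor: it carries full density where \<open>g\<close> drops and
      none elsewhere, so its net outflow is the integral of the positive part.\<close>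
    define k :: "'a \<times> 'a \<Rightarrow> real" where "k p = (if g (snd p) < g (fst p) then 1 else 0)" for p
    have "k \<in> borel_measurable \<psi>"
      unfolding k_def by measurable
    then have k: "k \<in> ?F"
      by (simp add: unit_functions_def k_def)
    have "(\<integral>p. max 0 (g (fst p) - g (snd p)) \<partial>\<psi>) = net_outflow \<psi> g k"
      unfolding net_outflow_def by (intro Bochner_Integration.integral_cong) (auto simp: k_def)
    moreover have "net_outflow \<psi> g k \<le> net_outflow \<psi> g f"
    proof -
      have *: "summable (\<lambda>n. (1 / 2) ^ n * (e f n * T n k))" if "k \<in> ?F" for k
        using mult_mono[OF e_le[OF f] T_le[OF that]] C0
        by (intro summable_geometric_weights[of _ "(C + 1) * C"]) (simp add: abs_mult)
      have "(1 / 2) ^ n * (e f n * (e k n - e f n)) =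
          (1 / 2) ^ n * (e f n * T n k) - (1 / 2) ^ n * (e f n * T n f)" for n
        by (simp add: e_def algebra_simps)
      then show ?thesis
        using stationary[OF k] suminf_diff[OF *[OF k] *[OF f]]
        by (simp add: g_flow[OF k] g_flow[OF f])
    qed
    ultimately show ?thesis
      by simp
  qed
  \<comment> \<open>Writing \<open>T n f\<close> as \<open>e f n + b n\<close>, the squared errors
    sum to \<Phi>, while the weighted sum of the products \<open>e f n * b n\<close> is -(g s - g
    t).\<close>
  also have "\<dots> = g s - g t - \<Phi> f"
  proof -
    have sb: "summable (\<lambda>n. (1 / 2) ^ n * (e f n * b n))"
      using mult_mono[OF e_le[OF f] b_le] C0
      by (intro summable_geometric_weights[of _ "C + 1"]) (simp add: abs_mult)
    have "e f n * T n f = (e f n)\<^sup>2 + e f n * b n" for n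
      by (simp add: e_def power2_eq_square algebra_simps)
    then show ?thesis
      using suminf_add[OF \<Phi>_summable[OF f] sb]
      by (simp add: g_flow[OF f] g_diff b_def[symmetric] \<Phi>_def distrib_left)
  qed
  \<comment> \<open>The chain gives g s - g t <= g s - g t - \<Phi>(f), so \<Phi>(f) is at most
    0.\<close>
  finally have "\<Phi> f = 0"
    using nonneg[OF f] by simp
  then have "e f n = 0" for n
    using suminf_eq_zero_iff[OF \<Phi>_summable[OF f]] by (simp add: \<Phi>_def)
  then show ?thesis
    using that[OF f] by (simp add: e_def T b_def)
qed

section \<open>Measures with density at most 1\<close>

lemma density_unit_function:
  fixes \<psi> :: "'b measure"
  assumes "finite_measure \<psi>" and f: "f \<in> unit_functions \<psi>"
  shows "finite_measure (density \<psi> f)"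
    and "X \<in> sets \<psi> \<Longrightarrow> measure (density \<psi> f) X = (\<integral>p. indicator X p * f p \<partial>\<psi>)"
    and "X \<in> sets \<psi> \<Longrightarrow> measure (density \<psi> f) X \<le> measure \<psi> X"
proof -
  interpret finite_measure \<psi> by fact
  have [measurable]: "f \<in> borel_measurable \<psi>" and bnd: "0 \<le> f p" "f p \<le> 1" for p
    using f unfolding unit_functions_def by blast+
  have le: "emeasure (density \<psi> f) X \<le> emeasure \<psi> X" if "X \<in> sets \<psi>" for X
  proof -
    have "emeasure (density \<psi> f) X \<le> (\<integral>\<^sup>+p. indicator X p \<partial>\<psi>)"
      using bnd by (subst emeasure_density[OF _ that]) (auto intro!: nn_integral_mono split: split_indicator)
    then show ?thesis
      using that by simp
  qed
  then show "finite_measure (density \<psi> f)"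
    by (intro finite_measureI) (metis emeasure_finite le space_density sets.top top.extremum_uniqueI infinity_ennreal_def)
  show "measure (density \<psi> f) X \<le> measure \<psi> X" if "X \<in> sets \<psi>"
    using le[OF that] unfolding measure_def by (intro enn2real_mono) (auto simp: less_top[symmetric])
  show "measure (density \<psi> f) X = (\<integral>p. indicator X p * f p \<partial>\<psi>)" if "X \<in> sets \<psi>"
  proof -
    have "measure (density \<psi> f) X = (\<integral>p. indicator X p \<partial>density \<psi> f)"
      using that sets.sets_into_space[OF that] by (simp add: Int_absorb2)
    also have "\<dots> = (\<integral>p. indicator X p * f p \<partial>\<psi>)"
      using that bnd by (subst integral_density) (auto simp: mult.commute)
    finally show ?thesis .
  qed
qed

section \<open>Equivalence of flows and cuts\<close>

theorem theorem4p10: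
  fixes M :: "'a measure" and \<psi> :: "('a \<times> 'a) measure" and s t :: 'a
  assumes "standard_borel M"
    and "finite_measure_on (M \<Otimes>\<^sub>M M) \<psi>"
    and "s \<in> space M" and "t \<in> space M"
  shows "(\<exists>\<phi>. st_flow M s t 1 \<phi> \<and>
            (\<forall>X\<in>sets (M \<Otimes>\<^sub>M M). measure \<phi> X \<le> measure \<psi> X)) \<longleftrightarrow>
         (\<forall>A\<in>sets M. s \<in> A \<and> t \<notin> A \<longrightarrow> measure \<psi> (A \<times> (space M - A)) \<ge> 1)"
proof (intro iffI ballI impI)
  fix A assume A: "A \<in> sets M" "s \<in> A \<and> t \<notin> A"
  assume "\<exists>\<phi>. st_flow M s t 1 \<phi> \<and> (\<forall>X\<in>sets (M \<Otimes>\<^sub>M M). measure \<phi> X \<le> measure \<psi> X)"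
  then obtain \<phi> where \<phi>: "finite_measure \<phi>" "sets \<phi> = sets (M \<Otimes>\<^sub>M M)"
    "\<And>A. A \<in> sets M \<Longrightarrow> measure \<phi> (A \<times> space M) - measure \<phi> (space M \<times> A) =
       measure (return M s) A - measure (return M t) A"
    "\<And>X. X \<in> sets (M \<Otimes>\<^sub>M M) \<Longrightarrow> measure \<phi> X \<le> measure \<psi> X"
    unfolding st_flow_def finite_measure_on_def by auto
  interpret finite_measure \<phi> by fact
  let ?B = "space M - A"
  \<comment> \<open>The mass inside \<open>A \<times> A\<close> cancels in the flow equation, so the
    mass leaving \<open>A\<close> exceeds the mass entering it by exactly 1.\<close>
  have split: "A \<times> space M = A \<times> A \<union> A \<times> ?B" "space M \<times> A = A \<times> A \<union> ?B \<times> A"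
    using sets.sets_into_space[OF A(1)] by auto
  have [measurable]: "A \<times> A \<in> sets \<phi>" "A \<times> ?B \<in> sets \<phi>" "?B \<times> A \<in> sets \<phi>"
    using A(1) by (auto simp: \<phi>(2))
  have "measure \<phi> (A \<times> space M) = measure \<phi> (A \<times> A) + measure \<phi> (A \<times> ?B)"
    "measure \<phi> (space M \<times> A) = measure \<phi> (A \<times> A) + measure \<phi> (?B \<times> A)"
    unfolding split by (intro finite_measure_Union; auto)+
  moreover have "measure \<phi> (A \<times> space M) - measure \<phi> (space M \<times> A) = 1"
    using \<phi>(3)[OF A(1)] A by (simp add: measure_return)
  ultimately have "1 \<le> measure \<phi> (A \<times> ?B)"
    using measure_nonneg[of \<phi> "?B \<times> A"] by linarith
  also have "\<dots> \<le> measure \<psi> (A \<times> ?B)"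
    using A(1) by (intro \<phi>(4)) auto
  finally show "1 \<le> measure \<psi> (A \<times> ?B)" .
next
  assume cut: "\<forall>A\<in>sets M. s \<in> A \<and> t \<notin> A \<longrightarrow> measure \<psi> (A \<times> (space M - A)) \<ge> 1"
  have fin: "finite_measure \<psi>" and sets: "sets \<psi> = sets (M \<Otimes>\<^sub>M M)"
    using assms(2) by (auto simp: finite_measure_on_def)
  have sp: "space \<psi> = space M \<times> space M"
    using sets_eq_imp_space_eq[OF sets] by (simp add: space_pair_measure)
  obtain A :: "nat \<Rightarrow> 'a set" where A: "Int_stable (range A)" "space M \<in> range A"
      "sets M = sigma_sets (space M) (range A)"
    using assms(1) by (rule standard_borel_countable_generator)
  have A_sets: "A n \<in> sets M" for n
    unfolding A(3) by auto
  obtain f where f: "f \<in> unit_functions \<psi>"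
    and flow: "\<forall>n. net_outflow \<psi> (indicator (A n)) f = indicator (A n) s - indicator (A n) t"
    by (rule flow_density_exists[OF fin sets assms(3,4) _ A_sets]) (use cut in blast)
  define \<phi> where "\<phi> = density \<psi> f"
  have \<phi>_fin: "finite_measure \<phi>" and \<phi>_sets: "sets \<phi> = sets (M \<Otimes>\<^sub>M M)"
    and \<phi>_space: "space \<phi> = space M \<times> space M"
    using density_unit_function(1)[OF fin f] by (auto simp: \<phi>_def sets sp)
  have [measurable_cong]: "sets \<phi> = sets (M \<Otimes>\<^sub>M M)" "sets \<psi> = sets (M \<Otimes>\<^sub>M M)"
    by fact+
  \<comment> \<open>Expressing the marginals as push-forwards makes them measures on
    \<open>M\<close>, to which the uniqueness result for differences applies.\<close>
  have marg: "measure (distr \<phi> M fst) B = measure \<phi> (B \<times> space M)"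
    "measure (distr \<phi> M snd) B = measure \<phi> (space M \<times> B)" if B: "B \<in> sets M" for B
  proof -
    have "fst -` B \<inter> space \<phi> = B \<times> space M" "snd -` B \<inter> space \<phi> = space M \<times> B"
      using sets.sets_into_space[OF B] by (auto simp: \<phi>_space)
    then show "measure (distr \<phi> M fst) B = measure \<phi> (B \<times> space M)"
      "measure (distr \<phi> M snd) B = measure \<phi> (space M \<times> B)"
      using B by (simp_all add: measure_distr)
  qed
  have outflow: "measure \<phi> (B \<times> space M) - measure \<phi> (space M \<times> B) = net_outflow \<psi> (indicator B) f"
    if B: "B \<in> sets M" for B
  proof -
    have S: "B \<times> space M \<in> sets \<psi>" "space M \<times> B \<in> sets \<psi>"
      using B by (auto simp: sets)
    have "integrable \<psi> (\<lambda>p. indicator X p * f p)" if "X \<in> sets \<psi>" for X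
      using f that by (intro finite_measure.integrable_bounded_by[OF fin, of _ 1])
        (auto simp: unit_functions_def indicator_def)
    then have "measure \<phi> (B \<times> space M) - measure \<phi> (space M \<times> B) =
        (\<integral>p. indicator (B \<times> space M) p * f p - indicator (space M \<times> B) p * f p \<partial>\<psi>)"
      using S unfolding \<phi>_def by (simp add: density_unit_function(2)[OF fin f])
    also have "\<dots> = net_outflow \<psi> (indicator B) f"
      unfolding net_outflow_def
      by (intro Bochner_Integration.integral_cong) (auto simp: sp indicator_def)
    finally show ?thesis .
  qed
  have conserve: "measure \<phi> (B \<times> space M) - measure \<phi> (space M \<times> B) =
      measure (return M s) B - measure (return M t) B" if B: "B \<in> sets M" for B
  proof -
    \<comment> \<open>The density was built to satisfy the equation only on the countable generator;
      the pi-system extends it to every measurable set.\<close>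
    have "measure (distr \<phi> M fst) B - measure (distr \<phi> M snd) B =
        measure (return M s) B - measure (return M t) B"
    proof (rule finite_measure_diff_eqI)
      show "finite_measure (distr \<phi> M fst)" "finite_measure (distr \<phi> M snd)"
        by (auto intro: finite_measure.finite_measure_distr[OF \<phi>_fin])
      show "finite_measure (return M s)" "finite_measure (return M t)"
        using prob_space_return[of _ M, THEN prob_space_imp_subprob_space] assms(3,4)
        by (auto intro: subprob_space.axioms(1))
      show "range A \<subseteq> Pow (space M)"
        using A_sets sets.sets_into_space by blast
      fix X assume "X \<in> range A"
      then obtain n where n: "X = A n"
        by blast
      show "measure (distr \<phi> M fst) X - measure (distr \<phi> M snd) X =
          measure (return M s) X - measure (return M t) X"
        unfolding n marg[OF A_sets] outflow[OF A_sets] flow[rule_format] using A_sets by (simp add: measure_return)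
    qed (use A B in auto)
    then show ?thesis
      by (simp add: marg[OF B])
  qed
  have "st_flow M s t 1 \<phi>"
    unfolding st_flow_def finite_measure_on_def using \<phi>_fin \<phi>_sets conserve by simp
  moreover have "\<forall>X\<in>sets (M \<Otimes>\<^sub>M M). measure \<phi> X \<le> measure \<psi> X"
    unfolding \<phi>_def using density_unit_function(3)[OF fin f] by (simp add: sets)
  ultimately show "\<exists>\<phi>. st_flow M s t 1 \<phi> \<and> (\<forall>X\<in>sets (M \<Otimes>\<^sub>M M). measure \<phi> X \<le> measure \<psi> X)"
    by blast
qed

end
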